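(* Under the a-priori realization: (1) the 2-person non-initialized game $(\mathcal{G}_2,u)$ has no uniform Nash equilibrium in mixed strategies whenever $$u_1(c)>u_1(a_1)>u_1(a_2),\qquad u_2(a_1)>u_2(a_2)>u_2(c);$$ (2) the 3-person non-initialized game $(\mathcal{G}_3,u)$ has no uniform Nash equilibrium in mixed strategies whenever $$u_1(a_2)>u_1(a_1)>u_1(a_3)>u_1(c),\quad u_2(a_3)>u_2(a_2)>u_2(a_1)>u_2(c),\quad u_3(a_1)>u_3(a_3)>u_3(a_2)>u_3(c).$$
   Context: For $n\in\{2,3\}$ the game structure $\mathcal{G}_n$ is as follows: the directed graph has non-terminal positions $v_1,\dots,v_n$, terminal positions $a_1,\dots,a_n$, and arcs $(v_1,v_2),\dots,(v_{n-1},v_n),(v_n,v_1)$ (the cycle) and $(v_i,a_i)$, $i=1,\dots,n$. Player $i\in\{1,\dots,n\}$ controls $v_i$. The outcomes are $a_1,\dots,a_n$ (termination there) and $c$ (infinite play). A payoff is $u:\{1,\dots,n\}\times\{a_1,\dots,a_n,c\}\to\mathbb{R}$, written $u_i(a)$. A mixed strategy of player $i$ is a number $p_i\in[0,1]$: the probability of choosing to follow the cycle from $v_i$; with probability $1-p_i$ the move to $a_i$ is chosen. Under the a-priori realization, before the play begins one move is drawn, independently, in every position according to these probabilities, and the play then follows these fixed moves (the same move is repeated whenever a position is revisited) until it terminates or cycles forever. Thus: For $\mathcal{G}_2$ the distribution on $(a_1,a_2,c)$ is $(1-p_1,\;p_1(1-p_2),\;p_1p_2)$ for initial position $v_1$ and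 $(p_2(1-p_1),\;1-p_2,\;p_1p_2)$ for $v_2$. For $\mathcal{G}_3$ the distribution on $(a_1,a_2,a_3,c)$ is $(1-p_1,\;p_1(1-p_2),\;p_1p_2(1-p_3),\;p_1p_2p_3)$ for $v_1$; $(p_2p_3(1-p_1),\;1-p_2,\;p_2(1-p_3),\;p_1p_2p_3)$ for $v_2$; $(p_3(1-p_1),\;p_3p_1(1-p_2),\;1-p_3,\;p_1p_2p_3)$ for $v_3$. Player $i$'s expected payoff is the corresponding expectation of $u_i$. A tuple $(p_1,\dots,p_n)\in[0,1]^n$ is a uniform Nash equilibrium (UNE) if for each initial position $v_j$, $j=1,\dots,n$, no player can strictly increase his expected payoff by changing only his own $p_i\in[0,1]$. *)

theory Defs
  imports "HOL-Probability.Probability"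
begin

datatype position = V nat | A nat

datatype outcome = Terminal nat | Cycle

text \<open>
  Positions are numbered from 1, as are the players: player \<open>i\<close> controls \<open>V i\<close>, and
  \<open>A i\<close> is terminal.  The cycle leads from \<open>V i\<close> to \<open>V (i mod n + 1)\<close>, hence from \<open>V n\<close> back
  to \<open>V 1\<close>.
\<close>

definition arcs :: "nat \<Rightarrow> (position \<times> position) set" where
  "arcs n = (\<Union>i\<in>{1..n}. {(V i, V (i mod n + 1)), (V i, A i)})"

text \<open>
  A pure strategy profile is a function \<open>s\<close>: player \<open>i\<close> follows the cycle from \<open>V i\<close> if \<open>s i\<close>
  and moves to \<open>A i\<close> otherwise.  A play that has reached a terminal position stays there, so
  plays can be indexed by all natural numbers.
\<close>

fun step :: "nat \<Rightarrow> (nat \<Rightarrow> bool) \<Rightarrow> position \<Rightarrow> position" where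
  "step n s (V i) = (if s i then V (i mod n + 1) else A i)"
| "step n s (A i) = A i"

definition play :: "nat \<Rightarrow> (nat \<Rightarrow> bool) \<Rightarrow> position \<Rightarrow> nat \<Rightarrow> position" where
  "play n s x k = (step n s ^^ k) x"

definition play_outcome :: "nat \<Rightarrow> position \<Rightarrow> (nat \<Rightarrow> bool) \<Rightarrow> outcome" where
  "play_outcome n x s =
     (if \<exists>k i. play n s x k = A i then Terminal (THE i. \<exists>k. play n s x k = A i) else Cycle)"

text \<open>
  The a-priori realization of a mixed profile \<open>p\<close>: one move is drawn in every non-terminal
  position, independently, with \<open>p i\<close> the probability of following the cycle from \<open>V i\<close>; the play
  then uses these fixed moves.  The third argument of \<^const>\<open>Pi_pmf\<close> only gives the (irrelevant)
  value outside \<open>{1..n}\<close>; note that \<^const>\<open>bernoulli_pmf\<close> is meaningful for arguments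
  in \<open>{0..1}\<close> only, which is where strategies live.
\<close>

definition apriori_outcome :: "nat \<Rightarrow> (nat \<Rightarrow> real) \<Rightarrow> nat \<Rightarrow> outcome pmf" where
  "apriori_outcome n p j =
     map_pmf (play_outcome n (V j)) (Pi_pmf {1..n} False (\<lambda>i. bernoulli_pmf (p i)))"

definition expected_payoff ::
    "nat \<Rightarrow> (nat \<Rightarrow> outcome \<Rightarrow> real) \<Rightarrow> (nat \<Rightarrow> real) \<Rightarrow> nat \<Rightarrow> nat \<Rightarrow> real" where
  "expected_payoff n u p j i = measure_pmf.expectation (apriori_outcome n p j) (u i)"

definition uniform_nash :: "nat \<Rightarrow> (nat \<Rightarrow> outcome \<Rightarrow> real) \<Rightarrow> (nat \<Rightarrow> real) \<Rightarrow> bool" where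
  "uniform_nash n u p \<longleftrightarrow>
     (\<forall>i\<in>{1..n}. p i \<in> {0..1}) \<and>
     (\<forall>j\<in>{1..n}. \<forall>i\<in>{1..n}. \<forall>q\<in>{0..1}.
        expected_payoff n u (p(i := q)) j i \<le> expected_payoff n u p j i)"

lemma arcs_eq_steps: "arcs n = {(V i, step n s (V i)) | i s. i \<in> {1..n}}" (is "_ = ?R")
proof
  have "(V i, V (i mod n + 1)) \<in> ?R" "(V i, A i) \<in> ?R" if "i \<in> {1..n}" for i
  proof -
    have "V (i mod n + 1) = step n (\<lambda>_. True) (V i)" "A i = step n (\<lambda>_. False) (V i)"
      by simp_all
    with that show "(V i, V (i mod n + 1)) \<in> ?R" "(V i, A i) \<in> ?R"
      by blast+
  qed
  then show "arcs n \<subseteq> ?R"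
    unfolding arcs_def by blast
qed (auto simp: arcs_def)

lemma play_terminal: "play n s (A i) k = A i"
  by (induction k) (simp_all add: play_def)

lemma play_Suc: "play n s x (Suc k) = play n s (step n s x) k"
  by (simp add: play_def funpow_swap1)

lemma play_outcome_terminal: "play_outcome n (A i) s = Terminal i"
  by (simp add: play_outcome_def play_terminal)

lemma play_outcome_step: "play_outcome n (V i) s = play_outcome n (step n s (V i)) s"
proof -
  have "(\<exists>k. play n s (V i) k = A l) \<longleftrightarrow> (\<exists>k. play n s (step n s (V i)) k = A l)" for l
  proof
    assume "\<exists>k. play n s (V i) k = A l"
    then obtain k where k: "play n s (V i) k = A l" ..
    then obtain m where "k = Suc m" by (cases k) (auto simp: play_def)
    with k show "\<exists>k. play n s (step n s (V i)) k = A l" by (auto simp: play_Suc)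
  next
    assume "\<exists>k. play n s (step n s (V i)) k = A l"
    then show "\<exists>k. play n s (V i) k = A l" by (metis play_Suc)
  qed
  then show ?thesis
    unfolding play_outcome_def by (subst (1 2) ex_comm) (simp only:)
qed

lemma play_outcome_cycle:
  assumes "\<forall>i\<in>{1..n}. s i" "j \<in> {1..n}"
  shows "play_outcome n (V j) s = Cycle"
proof -
  have "\<exists>i\<in>{1..n}. play n s (V j) k = V i" for k
  proof (induction k)
    case 0
    then show ?case using assms by (simp add: play_def)
  next
    case (Suc k)
    then obtain i where "i \<in> {1..n}" "play n s (V j) k = V i" by blast
    then have "play n s (V j) (Suc k) = V (i mod n + 1)" "i mod n + 1 \<in> {1..n}"
      using assms by (auto simp: play_def Suc_le_eq)
    then show ?case by blast
  qed
  then show ?thesis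
    unfolding play_outcome_def by (metis position.distinct(1))
qed

lemma play_outcome_2:
  "play_outcome 2 (V 1) s = (if \<not> s 1 then Terminal 1 else if \<not> s 2 then Terminal 2 else Cycle)"
  "play_outcome 2 (V 2) s = (if \<not> s 2 then Terminal 2 else if \<not> s 1 then Terminal 1 else Cycle)"
proof -
  have "{1..2::nat} = {1,2}" by auto
  then have c: "s 1 \<Longrightarrow> s 2 \<Longrightarrow> play_outcome 2 (V 1) s = Cycle"
    "s 1 \<Longrightarrow> s 2 \<Longrightarrow> play_outcome 2 (V 2) s = Cycle"
    by (auto intro!: play_outcome_cycle)
  have m: "1 mod 2 + 1 = (2::nat)" "2 mod 2 + 1 = (1::nat)" by simp_all
  note st = play_outcome_step[of 2 1 s] play_outcome_step[of 2 2 s]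
  note st' = st[unfolded step.simps m]
  show "play_outcome 2 (V 1) s = (if \<not> s 1 then Terminal 1 else if \<not> s 2 then Terminal 2 else Cycle)"
    using c st' play_outcome_terminal by metis
  show "play_outcome 2 (V 2) s = (if \<not> s 2 then Terminal 2 else if \<not> s 1 then Terminal 1 else Cycle)"
    using c st' play_outcome_terminal by metis
qed

lemma play_outcome_3:
  "play_outcome 3 (V 1) s = (if \<not> s 1 then Terminal 1 else if \<not> s 2 then Terminal 2
     else if \<not> s 3 then Terminal 3 else Cycle)"
  "play_outcome 3 (V 2) s = (if \<not> s 2 then Terminal 2 else if \<not> s 3 then Terminal 3
     else if \<not> s 1 then Terminal 1 else Cycle)"
  "play_outcome 3 (V 3) s = (if \<not> s 3 then Terminal 3 else if \<not> s 1 then Terminal 1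
     else if \<not> s 2 then Terminal 2 else Cycle)"
proof -
  have "{1..3::nat} = {1,2,3}" by auto
  then have c: "s 1 \<Longrightarrow> s 2 \<Longrightarrow> s 3 \<Longrightarrow> play_outcome 3 (V 1) s = Cycle"
    "s 1 \<Longrightarrow> s 2 \<Longrightarrow> s 3 \<Longrightarrow> play_outcome 3 (V 2) s = Cycle"
    "s 1 \<Longrightarrow> s 2 \<Longrightarrow> s 3 \<Longrightarrow> play_outcome 3 (V 3) s = Cycle"
    by (auto intro!: play_outcome_cycle)
  have m: "1 mod 3 + 1 = (2::nat)" "2 mod 3 + 1 = (3::nat)" "3 mod 3 + 1 = (1::nat)" by simp_all
  note st = play_outcome_step[of 3 1 s] play_outcome_step[of 3 2 s] play_outcome_step[of 3 3 s]
  note st' = st[unfolded step.simps m]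
  show "play_outcome 3 (V 1) s = (if \<not> s 1 then Terminal 1 else if \<not> s 2 then Terminal 2
     else if \<not> s 3 then Terminal 3 else Cycle)"
    "play_outcome 3 (V 2) s = (if \<not> s 2 then Terminal 2 else if \<not> s 3 then Terminal 3
     else if \<not> s 1 then Terminal 1 else Cycle)"
    "play_outcome 3 (V 3) s = (if \<not> s 3 then Terminal 3 else if \<not> s 1 then Terminal 1
     else if \<not> s 2 then Terminal 2 else Cycle)"
    by (metis c st' play_outcome_terminal)+
qed

text \<open>The resulting outcome distributions in closed form.\<close>

lemma pmf_bind_bernoulli:
  "0 \<le> q \<Longrightarrow> q \<le> 1 \<Longrightarrow>
   pmf (bernoulli_pmf q \<bind> f) x = q * pmf (f True) x + (1 - q) * pmf (f False) x"
  by (simp add: pmf_bind)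

lemma apriori_outcome_2:
  assumes "p 1 \<in> {0..1}" "p 2 \<in> {0..1}"
  shows "pmf (apriori_outcome 2 p 1) (Terminal 1) = 1 - p 1"
    "pmf (apriori_outcome 2 p 1) (Terminal 2) = p 1 * (1 - p 2)"
    "pmf (apriori_outcome 2 p 1) Cycle = p 1 * p 2"
    "pmf (apriori_outcome 2 p 2) (Terminal 1) = p 2 * (1 - p 1)"
    "pmf (apriori_outcome 2 p 2) (Terminal 2) = 1 - p 2"
    "pmf (apriori_outcome 2 p 2) Cycle = p 1 * p 2"
proof -
  have I: "{1..2::nat} = {1,2}" by auto
  have d: "apriori_outcome 2 p j =
    bernoulli_pmf (p 1) \<bind> (\<lambda>b1. bernoulli_pmf (p 2) \<bind> (\<lambda>b2. return_pmf (play_outcome 2 (V j) ((\<lambda>_. False)(2 := b2, 1 := b1)))))" for j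
    unfolding apriori_outcome_def I
    by (simp add: Pi_pmf_insert' map_bind_pmf bind_assoc_pmf bind_return_pmf del: One_nat_def)
  show "pmf (apriori_outcome 2 p 1) (Terminal 1) = 1 - p 1"
    "pmf (apriori_outcome 2 p 1) (Terminal 2) = p 1 * (1 - p 2)"
    "pmf (apriori_outcome 2 p 1) Cycle = p 1 * p 2"
    "pmf (apriori_outcome 2 p 2) (Terminal 1) = p 2 * (1 - p 1)"
    "pmf (apriori_outcome 2 p 2) (Terminal 2) = 1 - p 2"
    "pmf (apriori_outcome 2 p 2) Cycle = p 1 * p 2"
    using assms by (simp_all add: d pmf_bind_bernoulli play_outcome_2 algebra_simps del: One_nat_def)
qed

lemma apriori_outcome_3:
  assumes "p 1 \<in> {0..1}" "p 2 \<in> {0..1}" "p 3 \<in> {0..1}"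
  shows "pmf (apriori_outcome 3 p 1) (Terminal 1) = 1 - p 1"
    "pmf (apriori_outcome 3 p 1) (Terminal 2) = p 1 * (1 - p 2)"
    "pmf (apriori_outcome 3 p 1) (Terminal 3) = p 1 * p 2 * (1 - p 3)"
    "pmf (apriori_outcome 3 p 1) Cycle = p 1 * p 2 * p 3"
    "pmf (apriori_outcome 3 p 2) (Terminal 1) = p 2 * p 3 * (1 - p 1)"
    "pmf (apriori_outcome 3 p 2) (Terminal 2) = 1 - p 2"
    "pmf (apriori_outcome 3 p 2) (Terminal 3) = p 2 * (1 - p 3)"
    "pmf (apriori_outcome 3 p 2) Cycle = p 1 * p 2 * p 3"
    "pmf (apriori_outcome 3 p 3) (Terminal 1) = p 3 * (1 - p 1)"
    "pmf (apriori_outcome 3 p 3) (Terminal 2) = p 3 * p 1 * (1 - p 2)"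
    "pmf (apriori_outcome 3 p 3) (Terminal 3) = 1 - p 3"
    "pmf (apriori_outcome 3 p 3) Cycle = p 1 * p 2 * p 3"
proof -
  have I: "{1..3::nat} = {1,2,3}" by auto
  have d: "apriori_outcome 3 p j =
    bernoulli_pmf (p 1) \<bind> (\<lambda>b1. bernoulli_pmf (p 2) \<bind> (\<lambda>b2. bernoulli_pmf (p 3) \<bind> (\<lambda>b3. return_pmf (play_outcome 3 (V j) ((\<lambda>_. False)(3 := b3, 2 := b2, 1 := b1))))))" for j
    unfolding apriori_outcome_def I
    by (simp add: Pi_pmf_insert' map_bind_pmf bind_assoc_pmf bind_return_pmf del: One_nat_def)
  show "pmf (apriori_outcome 3 p 1) (Terminal 1) = 1 - p 1"
    "pmf (apriori_outcome 3 p 1) (Terminal 2) = p 1 * (1 - p 2)"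
    "pmf (apriori_outcome 3 p 1) (Terminal 3) = p 1 * p 2 * (1 - p 3)"
    "pmf (apriori_outcome 3 p 1) Cycle = p 1 * p 2 * p 3"
    "pmf (apriori_outcome 3 p 2) (Terminal 1) = p 2 * p 3 * (1 - p 1)"
    "pmf (apriori_outcome 3 p 2) (Terminal 2) = 1 - p 2"
    "pmf (apriori_outcome 3 p 2) (Terminal 3) = p 2 * (1 - p 3)"
    "pmf (apriori_outcome 3 p 2) Cycle = p 1 * p 2 * p 3"
    "pmf (apriori_outcome 3 p 3) (Terminal 1) = p 3 * (1 - p 1)"
    "pmf (apriori_outcome 3 p 3) (Terminal 2) = p 3 * p 1 * (1 - p 2)"
    "pmf (apriori_outcome 3 p 3) (Terminal 3) = 1 - p 3"
    "pmf (apriori_outcome 3 p 3) Cycle = p 1 * p 2 * p 3"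
    using assms by (simp_all add: d pmf_bind_bernoulli play_outcome_3 algebra_simps del: One_nat_def)
qed

end

theory Submission
  imports Defs
begin

text \<open>
  For each initial position the payoff of a player is an affine function of his own probability,
  so in an equilibrium he plays 1 where the slope is positive and 0 where it is negative.

  In the 2-person game, if \<open>p 2 > 0\<close> then the play from \<open>V 2\<close> forces \<open>p 1 = 1\<close>, and the play from
  \<open>V 1\<close> in turn forces \<open>p 2 = 0\<close>; but \<open>p 2 = 0\<close> forces \<open>p 1 = 0\<close> from \<open>V 1\<close> and hence \<open>p 2 = 1\<close>
  from \<open>V 2\<close>.

  The 3-person game is cyclically symmetric: every player prefers the terminal of his successor
  to his own, his own to that of his predecessor, and each of them to the cycle.  If all
  probabilities were positive, starting at the successor of a player would force his probability
  to be 0.  So some probability vanishes; then the predecessor plays 1 and the player before him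
  plays 0, so the first player plays 1, a contradiction.
\<close>

lemma affine_maximizer:
  fixes p \<alpha> \<beta> :: real
  assumes "p \<in> {0..1}" "\<And>q. q \<in> {0..1} \<Longrightarrow> \<alpha> + q * \<beta> \<le> \<alpha> + p * \<beta>"
  shows "\<beta> > 0 \<Longrightarrow> p = 1" "\<beta> < 0 \<Longrightarrow> p = 0"
  \<comment> \<open>The endpoints are enough: \<open>q = 1\<close> gives (1 - p) * \<beta> \<le> 0
    and \<open>q = 0\<close> gives 0 \<le> p * \<beta>.\<close>
  using assms(1) assms(2)[of 0] assms(2)[of 1]
  by (auto simp: mult_le_0_iff zero_le_mult_iff)

text \<open>The form in which both games use the equilibrium condition: a slope computed for any
  single initial position \<open>j\<close> already decides \<open>p i\<close> by its sign.\<close>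

lemma uniform_nash_affine:
  assumes "uniform_nash n u p" "i \<in> {1..n}" "j \<in> {1..n}"
    and "\<And>q. q \<in> {0..1} \<Longrightarrow> expected_payoff n u (p(i := q)) j i = \<alpha> + q * \<beta>"
  shows "\<beta> > 0 \<Longrightarrow> p i = 1" "\<beta> < 0 \<Longrightarrow> p i = 0"
proof -
  have p: "p i \<in> {0..1}"
    using assms(1,2) by (simp add: uniform_nash_def)
  have "\<alpha> + q * \<beta> \<le> \<alpha> + p i * \<beta>" if "q \<in> {0..1}" for q
  proof -
    have "expected_payoff n u (p(i := q)) j i \<le> expected_payoff n u p j i"
      using assms(1-3) that by (simp add: uniform_nash_def)
    \<comment> \<open>Taking \<open>q = p i\<close> evaluates the payoff of \<open>p\<close> itself,
      since updating \<open>p\<close> at \<open>i\<close> by \<open>p i\<close> changes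
      nothing.\<close>
    with assms(4)[OF that] assms(4)[OF p] show ?thesis by simp
  qed
  with p show "\<beta> > 0 \<Longrightarrow> p i = 1" "\<beta> < 0 \<Longrightarrow> p i = 0"
    using affine_maximizer by blast+
qed

text \<open>The type \<open>outcome\<close> has infinitely many terminals, so the support is first
  confined to the three possible outcomes; the expectation is then a finite sum.\<close>

lemma expected_payoff_2:
  assumes "p 1 \<in> {0..1}" "p 2 \<in> {0..1}"
  shows "expected_payoff 2 u p 1 i =
      (1 - p 1) * u i (Terminal 1) + p 1 * (1 - p 2) * u i (Terminal 2) + p 1 * p 2 * u i Cycle" (is ?P1)
    "expected_payoff 2 u p 2 i =
      p 2 * (1 - p 1) * u i (Terminal 1) + (1 - p 2) * u i (Terminal 2) + p 1 * p 2 * u i Cycle" (is ?P2)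
proof -
  let ?O = "{Terminal 1, Terminal 2, Cycle}"
  have "set_pmf (apriori_outcome 2 p j) \<subseteq> ?O" if "j \<in> {1, 2}" for j
    using that by (auto simp: apriori_outcome_def play_outcome_2 simp del: One_nat_def split: if_splits)
  then have "expected_payoff 2 u p j i =
      (\<Sum>x\<in>?O. pmf (apriori_outcome 2 p j) x * u i x)"
    if "j \<in> {1, 2}" for j
    using that unfolding expected_payoff_def
    by (subst integral_measure_pmf[where A = ?O]) auto
  then show ?P1 ?P2
    by (simp_all add: apriori_outcome_2[OF assms] del: One_nat_def)
qed

lemma expected_payoff_3:
  assumes "p 1 \<in> {0..1}" "p 2 \<in> {0..1}" "p 3 \<in> {0..1}"
  shows "expected_payoff 3 u p 1 i =
      (1 - p 1) * u i (Terminal 1) + p 1 * (1 - p 2) * u i (Terminal 2) +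
      p 1 * p 2 * (1 - p 3) * u i (Terminal 3) + p 1 * p 2 * p 3 * u i Cycle" (is ?P1)
    "expected_payoff 3 u p 2 i =
      p 2 * p 3 * (1 - p 1) * u i (Terminal 1) + (1 - p 2) * u i (Terminal 2) +
      p 2 * (1 - p 3) * u i (Terminal 3) + p 1 * p 2 * p 3 * u i Cycle" (is ?P2)
    "expected_payoff 3 u p 3 i =
      p 3 * (1 - p 1) * u i (Terminal 1) + p 3 * p 1 * (1 - p 2) * u i (Terminal 2) +
      (1 - p 3) * u i (Terminal 3) + p 1 * p 2 * p 3 * u i Cycle" (is ?P3)
proof -
  let ?O = "{Terminal 1, Terminal 2, Terminal 3, Cycle}"
  have "set_pmf (apriori_outcome 3 p j) \<subseteq> ?O" if "j \<in> {1, 2, 3}" for j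
    using that by (auto simp: apriori_outcome_def play_outcome_3 simp del: One_nat_def split: if_splits)
  then have "expected_payoff 3 u p j i = (\<Sum>x\<in>?O. pmf (apriori_outcome 3 p j) x * u i x)"
    if "j \<in> {1, 2, 3}" for j
    using that unfolding expected_payoff_def
    by (subst integral_measure_pmf[where A = ?O]) auto
  then show ?P1 ?P2 ?P3
    by (simp_all add: apriori_outcome_3[OF assms] del: One_nat_def)
qed

lemma no_uniform_nash_2:
  fixes u :: "nat \<Rightarrow> outcome \<Rightarrow> real"
  assumes u1: "u 1 Cycle > u 1 (Terminal 1)" "u 1 (Terminal 1) > u 1 (Terminal 2)"
    and u2: "u 2 (Terminal 1) > u 2 (Terminal 2)" "u 2 (Terminal 2) > u 2 Cycle"
  shows "\<not> uniform_nash 2 u p"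
proof
  assume N: "uniform_nash 2 u p"
  have p: "p 1 \<in> {0..1}" "p 2 \<in> {0..1}"
    using N by (auto simp: uniform_nash_def)
  have pl: "1 \<in> {1..2::nat}" "2 \<in> {1..2::nat}" by simp_all
  note payoff = expected_payoff_2 algebra_simps
  \<comment> \<open>In the names \<open>s11\<close> to \<open>s22\<close> the first digit is the
    player and the second the initial position.\<close>
  have s11: "expected_payoff 2 u (p(1 := q)) 1 1 = u 1 (Terminal 1) +
      q * ((1 - p 2) * u 1 (Terminal 2) + p 2 * u 1 Cycle - u 1 (Terminal 1))"
    if "q \<in> {0..1}" for q
    using p that by (simp add: payoff del: One_nat_def)
  have s12: "expected_payoff 2 u (p(1 := q)) 2 1 =
      p 2 * u 1 (Terminal 1) + (1 - p 2) * u 1 (Terminal 2) +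
      q * (p 2 * (u 1 Cycle - u 1 (Terminal 1)))"
    if "q \<in> {0..1}" for q
    using p that by (simp add: payoff del: One_nat_def)
  have s21: "expected_payoff 2 u (p(2 := q)) 1 2 =
      (1 - p 1) * u 2 (Terminal 1) + p 1 * u 2 (Terminal 2) +
      q * (p 1 * (u 2 Cycle - u 2 (Terminal 2)))"
    if "q \<in> {0..1}" for q
    using p that by (simp add: payoff del: One_nat_def)
  have s22: "expected_payoff 2 u (p(2 := q)) 2 2 = u 2 (Terminal 2) +
      q * ((1 - p 1) * u 2 (Terminal 1) + p 1 * u 2 Cycle - u 2 (Terminal 2))"
    if "q \<in> {0..1}" for q
    using p that by (simp add: payoff del: One_nat_def)
  note b11 = uniform_nash_affine[OF N pl(1) pl(1) s11]
  note b12 = uniform_nash_affine[OF N pl(1) pl(2) s12]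
  note b21 = uniform_nash_affine[OF N pl(2) pl(1) s21]
  note b22 = uniform_nash_affine[OF N pl(2) pl(2) s22]
  have "p 2 > 0 \<Longrightarrow> p 1 = 1"
    using b12(1) u1 by simp
  moreover have "p 1 = 1 \<Longrightarrow> p 2 = 0"
    using b21(2) u2 by simp
  \<comment> \<open>With \<open>p 2 = 0\<close> the slope in \<open>s11\<close> reduces to
    \<open>u 1 (Terminal 2) - u 1 (Terminal 1)\<close>.\<close>
  moreover have "p 2 = 0 \<Longrightarrow> p 1 = 0"
    using b11(2) u1 by simp
  moreover have "p 1 = 0 \<Longrightarrow> p 2 = 1"
    using b22(1) u2 by simp
  ultimately show False
    using p by fastforce
qed

lemma no_uniform_nash_3:
  fixes u :: "nat \<Rightarrow> outcome \<Rightarrow> real"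
  assumes u1: "u 1 (Terminal 2) > u 1 (Terminal 1)" "u 1 (Terminal 1) > u 1 (Terminal 3)"
      "u 1 (Terminal 3) > u 1 Cycle"
    and u2: "u 2 (Terminal 3) > u 2 (Terminal 2)" "u 2 (Terminal 2) > u 2 (Terminal 1)"
      "u 2 (Terminal 1) > u 2 Cycle"
    and u3: "u 3 (Terminal 1) > u 3 (Terminal 3)" "u 3 (Terminal 3) > u 3 (Terminal 2)"
      "u 3 (Terminal 2) > u 3 Cycle"
  shows "\<not> uniform_nash 3 u p"
proof
  assume N: "uniform_nash 3 u p"
  have p: "p 1 \<in> {0..1}" "p 2 \<in> {0..1}" "p 3 \<in> {0..1}"
    using N by (auto simp: uniform_nash_def)
  have pl: "1 \<in> {1..3::nat}" "2 \<in> {1..3::nat}" "3 \<in> {1..3::nat}" by simp_all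
  note payoff = expected_payoff_3 algebra_simps
  have own1: "expected_payoff 3 u (p(1 := q)) 1 1 = u 1 (Terminal 1) +
      q * ((1 - p 2) * u 1 (Terminal 2) + p 2 * (1 - p 3) * u 1 (Terminal 3) +
        p 2 * p 3 * u 1 Cycle - u 1 (Terminal 1))"
    if "q \<in> {0..1}" for q
    using p that by (simp add: payoff del: One_nat_def)
  \<comment> \<open>The prefix \<open>own\<close> means starting at the player's own position,
    \<open>next\<close> at its successor. In the latter case the player moves last: the choice
    matters only if both others follow the cycle, and is then between \<open>Cycle\<close> and the
    own terminal.\<close>
  have next1: "expected_payoff 3 u (p(1 := q)) 2 1 =
      (1 - p 2) * u 1 (Terminal 2) + p 2 * (1 - p 3) * u 1 (Terminal 3) +
      p 2 * p 3 * u 1 (Terminal 1) + q * (p 2 * p 3 * (u 1 Cycle - u 1 (Terminal 1)))"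
    if "q \<in> {0..1}" for q
    using p that by (simp add: payoff del: One_nat_def)
  have own2: "expected_payoff 3 u (p(2 := q)) 2 2 = u 2 (Terminal 2) +
      q * ((1 - p 3) * u 2 (Terminal 3) + p 3 * (1 - p 1) * u 2 (Terminal 1) +
        p 3 * p 1 * u 2 Cycle - u 2 (Terminal 2))"
    if "q \<in> {0..1}" for q
    using p that by (simp add: payoff del: One_nat_def)
  have next2: "expected_payoff 3 u (p(2 := q)) 3 2 =
      (1 - p 3) * u 2 (Terminal 3) + p 3 * (1 - p 1) * u 2 (Terminal 1) +
      p 3 * p 1 * u 2 (Terminal 2) + q * (p 3 * p 1 * (u 2 Cycle - u 2 (Terminal 2)))"
    if "q \<in> {0..1}" for q
    using p that by (simp add: payoff del: One_nat_def)
  have own3: "expected_payoff 3 u (p(3 := q)) 3 3 = u 3 (Terminal 3) +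
      q * ((1 - p 1) * u 3 (Terminal 1) + p 1 * (1 - p 2) * u 3 (Terminal 2) +
        p 1 * p 2 * u 3 Cycle - u 3 (Terminal 3))"
    if "q \<in> {0..1}" for q
    using p that by (simp add: payoff del: One_nat_def)
  have next3: "expected_payoff 3 u (p(3 := q)) 1 3 =
      (1 - p 1) * u 3 (Terminal 1) + p 1 * (1 - p 2) * u 3 (Terminal 2) +
      p 1 * p 2 * u 3 (Terminal 3) + q * (p 1 * p 2 * (u 3 Cycle - u 3 (Terminal 3)))"
    if "q \<in> {0..1}" for q
    using p that by (simp add: payoff del: One_nat_def)
  note own_best1 = uniform_nash_affine[OF N pl(1) pl(1) own1]
  note next_best1 = uniform_nash_affine[OF N pl(1) pl(2) next1]
  note own_best2 = uniform_nash_affine[OF N pl(2) pl(2) own2]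
  note next_best2 = uniform_nash_affine[OF N pl(2) pl(3) next2]
  note own_best3 = uniform_nash_affine[OF N pl(3) pl(3) own3]
  note next_best3 = uniform_nash_affine[OF N pl(3) pl(1) next3]
  have "p 2 > 0 \<Longrightarrow> p 3 > 0 \<Longrightarrow> p 1 = 0" "p 3 > 0 \<Longrightarrow> p 1 > 0 \<Longrightarrow> p 2 = 0"
    "p 1 > 0 \<Longrightarrow> p 2 > 0 \<Longrightarrow> p 3 = 0"
    using next_best1(2) next_best2(2) next_best3(2) u1 u2 u3 by (simp_all add: mult_pos_neg)
  \<comment> \<open>If the successor surely terminates, following the cycle yields the successor's
    terminal, the favourite one.\<close>
  moreover have "p 2 = 0 \<Longrightarrow> p 1 = 1" "p 3 = 0 \<Longrightarrow> p 2 = 1" "p 1 = 0 \<Longrightarrow> p 3 = 1"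
    using own_best1(1) own_best2(1) own_best3(1) u1 u2 u3 by simp_all
  \<comment> \<open>Here following the cycle surely ends at the predecessor's terminal, which is
    worse than the own one.\<close>
  moreover have "p 2 = 1 \<Longrightarrow> p 3 = 0 \<Longrightarrow> p 1 = 0" "p 3 = 1 \<Longrightarrow> p 1 = 0 \<Longrightarrow> p 2 = 0"
    "p 1 = 1 \<Longrightarrow> p 2 = 0 \<Longrightarrow> p 3 = 0"
    using own_best1(2) own_best2(2) own_best3(2) u1 u2 u3 by simp_all
  \<comment> \<open>For instance, \<open>p 2 = 0\<close> gives \<open>p 1 = 1\<close>, these two
    give \<open>p 3 = 0\<close>, and that gives \<open>p 2 = 1\<close>.\<close>
  ultimately show False
    using p by fastforce
qed

theorem proposition7:
  shows "(\<forall>u :: nat \<Rightarrow> outcome \<Rightarrow> real.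
            u 1 Cycle > u 1 (Terminal 1) \<and> u 1 (Terminal 1) > u 1 (Terminal 2) \<and>
            u 2 (Terminal 1) > u 2 (Terminal 2) \<and> u 2 (Terminal 2) > u 2 Cycle
            \<longrightarrow> \<not> (\<exists>p. uniform_nash 2 u p)) \<and>
         (\<forall>u :: nat \<Rightarrow> outcome \<Rightarrow> real.
            u 1 (Terminal 2) > u 1 (Terminal 1) \<and> u 1 (Terminal 1) > u 1 (Terminal 3) \<and>
              u 1 (Terminal 3) > u 1 Cycle \<and>
            u 2 (Terminal 3) > u 2 (Terminal 2) \<and> u 2 (Terminal 2) > u 2 (Terminal 1) \<and>
              u 2 (Terminal 1) > u 2 Cycle \<and>
            u 3 (Terminal 1) > u 3 (Terminal 3) \<and> u 3 (Terminal 3) > u 3 (Terminal 2) \<and>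
              u 3 (Terminal 2) > u 3 Cycle
            \<longrightarrow> \<not> (\<exists>p. uniform_nash 3 u p))"
  using no_uniform_nash_2 no_uniform_nash_3 by blast

end
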